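(* Let $(\mathcal L,[-,-,-])$ be a ternary Leibniz algebra over a field $\mathbb{K}$ and let $N:\mathcal L\to\mathcal L$ be a Nijenhuis operator on it. Then: 1) $\mathcal L$ is a ternary Leibniz algebra with respect to the bracket $$[x,y,z]_N:=[N(x),N(y),z]+[N(x),y,N(z)]+[x,N(y),N(z)]-N\big([N(x),y,z]+[x,y,N(z)]+[x,N(y),z]\big)+N^2([x,y,z]),\quad x,y,z\in\mathcal L.$$ 2) $N$ is a morphism of ternary Leibniz algebras from $(\mathcal L,[-,-,-]_N)$ to $(\mathcal L,[-,-,-])$. 3) $N$ is also a Nijenhuis operator on $(\mathcal L,[-,-,-]_N)$.
   Context: A (right) ternary Leibniz algebra is a vector space with a trilinear bracket satisfying $[[x,y,z],t,u]=[x,y,[z,t,u]]+[x,[y,t,u],z]+[[x,t,u],y,z]$ for all elements. A morphism of ternary Leibniz algebras is a linear map preserving the ternary bracket. A Nijenhuis operator on a ternary Leibniz algebra $(\mathcal L,[-,-,-])$ is a linear map $N:\mathcal L\to\mathcal L$ such that for all $x,y,z\in\mathcal L$ $$[N(x),N(y),N(z)]=N\Big([N(x),N(y),z]+[N(x),y,N(z)]+[x,N(y),N(z)]-N\big([N(x),y,z]+[x,N(y),z]+[x,y,N(z)]\big)+N^2([x,y,z])\Big).$$ *)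

theory Defs
  imports Complex_Main
begin

definition trilinear ::
    "('k::field \<Rightarrow> 'v::ab_group_add \<Rightarrow> 'v) \<Rightarrow> ('v \<Rightarrow> 'v \<Rightarrow> 'v \<Rightarrow> 'v) \<Rightarrow> bool" where
  "trilinear scale br \<longleftrightarrow>
     (\<forall>y z. Vector_Spaces.linear scale scale (\<lambda>x. br x y z)) \<and>
     (\<forall>x z. Vector_Spaces.linear scale scale (\<lambda>y. br x y z)) \<and>
     (\<forall>x y. Vector_Spaces.linear scale scale (\<lambda>z. br x y z))"

text \<open>Right ternary Leibniz algebras. The underlying vector space is the whole type
  \<open>'v\<close>, with scalar multiplication \<open>scale\<close> over the field \<open>'k\<close>; no dimension or
  characteristic restriction is imposed.\<close>

locale ternary_leibniz_algebra = vector_space scale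
  for scale :: "'k::field \<Rightarrow> 'v::ab_group_add \<Rightarrow> 'v" +
  fixes br :: "'v \<Rightarrow> 'v \<Rightarrow> 'v \<Rightarrow> 'v"
  assumes trilinear_br: "trilinear scale br"
    and leibniz: "br (br x y z) t u = br x y (br z t u) + br x (br y t u) z + br (br x t u) y z"

locale ternary_leibniz_hom =
  source: ternary_leibniz_algebra scale1 br1 +
  target: ternary_leibniz_algebra scale2 br2 +
  Vector_Spaces.linear scale1 scale2 f
  for scale1 :: "'k::field \<Rightarrow> 'v::ab_group_add \<Rightarrow> 'v" and br1 :: "'v \<Rightarrow> 'v \<Rightarrow> 'v \<Rightarrow> 'v"
    and scale2 :: "'k \<Rightarrow> 'w::ab_group_add \<Rightarrow> 'w" and br2 :: "'w \<Rightarrow> 'w \<Rightarrow> 'w \<Rightarrow> 'w"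
    and f :: "'v \<Rightarrow> 'w" +
  assumes hom_br: "f (br1 x y z) = br2 (f x) (f y) (f z)"

locale nijenhuis_operator =
  ternary_leibniz_algebra scale br + Vector_Spaces.linear scale scale N
  for scale :: "'k::field \<Rightarrow> 'v::ab_group_add \<Rightarrow> 'v" and br :: "'v \<Rightarrow> 'v \<Rightarrow> 'v \<Rightarrow> 'v"
    and N :: "'v \<Rightarrow> 'v" +
  assumes nijenhuis:
    "br (N x) (N y) (N z) =
       N (br (N x) (N y) z + br (N x) y (N z) + br x (N y) (N z)
          - N (br (N x) y z + br x (N y) z + br x y (N z))
          + N (N (br x y z)))"

definition nijenhuis_bracket ::
    "('v::ab_group_add \<Rightarrow> 'v \<Rightarrow> 'v \<Rightarrow> 'v) \<Rightarrow> ('v \<Rightarrow> 'v) \<Rightarrow> 'v \<Rightarrow> 'v \<Rightarrow> 'v \<Rightarrow> 'v" where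
  "nijenhuis_bracket br N x y z =
     br (N x) (N y) z + br (N x) y (N z) + br x (N y) (N z)
     - N (br (N x) y z + br x y (N z) + br x (N y) z)
     + N (N (br x y z))"

end

theory Submission
  imports Defs
begin

text \<open>Put \<open>T = 1 + s N\<close> over the power series in \<open>s\<close>. The Nijenhuis identity says that the bracket
  transported along the invertible map \<open>T\<close> is a polynomial of degree 2 in \<open>s\<close>, with
  \<open>[x,y,z]\<^sub>N\<close> as its top coefficient. A transported bracket is again Leibniz, and the coefficient of
  \<open>s^4\<close> of this identity is the Leibniz identity for \<open>[x,y,z]\<^sub>N\<close>. Concretely, a composite of two
  deformed brackets equals the \<open>s^4\<close>-coefficient of \<open>T\<^sup>-\<^sup>1 F(T x, T y, T z, T t, T u)\<close>, where \<open>F\<close> is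
  the composite of the original brackets; this coefficient is additive in \<open>F\<close>.\<close>

definition transport4 ::
    "('v::ab_group_add \<Rightarrow> 'v) \<Rightarrow> ('v \<Rightarrow> 'v \<Rightarrow> 'v \<Rightarrow> 'v \<Rightarrow> 'v \<Rightarrow> 'v) \<Rightarrow>
      'v \<Rightarrow> 'v \<Rightarrow> 'v \<Rightarrow> 'v \<Rightarrow> 'v \<Rightarrow> 'v" where
  "transport4 N F x y z t u =
     (F x (N y) (N z) (N t) (N u) + F (N x) y (N z) (N t) (N u) + F (N x) (N y) z (N t) (N u)
      + F (N x) (N y) (N z) t (N u) + F (N x) (N y) (N z) (N t) u)
     - N (F x y (N z) (N t) (N u) + F x (N y) z (N t) (N u) + F x (N y) (N z) t (N u)
      + F x (N y) (N z) (N t) u + F (N x) y z (N t) (N u) + F (N x) y (N z) t (N u)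
      + F (N x) y (N z) (N t) u + F (N x) (N y) z t (N u) + F (N x) (N y) z (N t) u
      + F (N x) (N y) (N z) t u)
     + N (N (F (N x) (N y) z t u + F (N x) y (N z) t u + F (N x) y z (N t) u
      + F (N x) y z t (N u) + F x (N y) (N z) t u + F x (N y) z (N t) u + F x (N y) z t (N u)
      + F x y (N z) (N t) u + F x y (N z) t (N u) + F x y z (N t) (N u)))
     - N (N (N (F (N x) y z t u + F x (N y) z t u + F x y (N z) t u + F x y z (N t) u
      + F x y z t (N u))))
     + N (N (N (N (F x y z t u))))"

lemma transport4_add:
  assumes "additive N"
  shows "transport4 N (\<lambda>x y z t u. F x y z t u + G x y z t u) x y z t u =
    transport4 N F x y z t u + transport4 N G x y z t u"
  unfolding transport4_def
  by (simp add: additive.add[OF assms] algebra_simps)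

text \<open>\<open>f\<close> and \<open>g\<close> may differ, so that the outer bracket can be taken
  with its arguments permuted. The Nijenhuis identity for \<open>g\<close> turns \<open>N\<close> of
  the inner bracket into an undeformed value; the one for \<open>f\<close> moves \<open>N\<close>
  out of the first argument.\<close>

lemma nijenhuis_bracket_compose:
  assumes N: "additive N"
    and f: "\<And>t u. additive (\<lambda>a. f a t u)"
    and nf: "\<And>a t u. f (N a) (N t) (N u) = N (nijenhuis_bracket f N a t u)"
    and ng: "\<And>x y z. g (N x) (N y) (N z) = N (nijenhuis_bracket g N x y z)"
  shows "nijenhuis_bracket f N (nijenhuis_bracket g N x y z) t u =
    transport4 N (\<lambda>x y z t u. f (g x y z) t u) x y z t u"
proof -
  \<comment> \<open>Indices count occurrences of \<open>N\<close>: on \<open>t\<close>,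
    \<open>u\<close> for \<open>E0\<close> to \<open>E2\<close>, on \<open>x\<close>,
    \<open>y\<close>, \<open>z\<close> for \<open>s0\<close> to \<open>s3\<close>. The part of
    \<open>transport4\<close> under k outer \<open>N\<close>s is the sum of all Ei sj with i + j = 4
    - k.\<close>
  define E0 where "E0 a = f a t u" for a
  define E1 where "E1 a = f a (N t) u + f a t (N u)" for a
  define E2 where "E2 a = f a (N t) (N u)" for a
  define s0 where "s0 = g x y z"
  define s1 where "s1 = g (N x) y z + g x (N y) z + g x y (N z)"
  define s2 where "s2 = g (N x) (N y) z + g (N x) y (N z) + g x (N y) (N z)"
  define s3 where "s3 = g (N x) (N y) (N z)"
  define b where "b = nijenhuis_bracket g N x y z"
  define c where "c = s1 - N s0"
  note E_defs = E0_def E1_def E2_def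
  note s_defs = s0_def s1_def s2_def s3_def
  note f_add = additive.add[OF f]
  have E: "additive E0" "additive E1" "additive E2"
    by (auto intro!: additive.intro simp: E_defs f_add ac_simps)
  note lin = additive.add[OF N] additive.diff[OF N]
    E[THEN additive.add] E[THEN additive.diff]
  have bracket: "nijenhuis_bracket f N a t u =
      E2 a + E1 (N a) - N (E1 a) - N (E0 (N a)) + N (N (E0 a))" for a
    unfolding nijenhuis_bracket_def E_defs lin by (simp add: algebra_simps)
  have nE: "E2 (N a) = N (E2 a) + N (E1 (N a)) - N (N (E1 a)) - N (N (E0 (N a))) + N (N (N (E0 a)))"
    for a
    using nf[of a t u, unfolded bracket] by (simp only: lin E2_def)
  have b: "b = s2 - N c"
    unfolding b_def c_def s_defs nijenhuis_bracket_def lin by (simp add: algebra_simps)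
  have Nb: "N b = s3"
    unfolding b_def s3_def ng ..
  \<comment> \<open>With \<open>b = s2 - N c\<close>, expanding \<open>E2 (N c)\<close> by
    \<open>nE\<close> cancels all terms in \<open>E1 (N c)\<close> and
    \<open>E0 (N c)\<close>.\<close>
  have "nijenhuis_bracket f N b t u = E2 s2 + E1 s3 - N (E1 s2) - N (E0 s3) + N (N (E0 s2))
      - N (E2 c) + N (N (E1 c)) - N (N (N (E0 c)))"
    unfolding bracket Nb unfolding b lin nE by (simp add: algebra_simps)
  \<comment> \<open>The same cancellation, now for \<open>N s0\<close> in
    \<open>c = s1 - N s0\<close>.\<close>
  also have "\<dots> = (E2 s2 + E1 s3) - N (E1 s2 + E0 s3 + E2 s1) + N (N (E0 s2 + E1 s1 + E2 s0))
      - N (N (N (E0 s1 + E1 s0))) + N (N (N (N (E0 s0))))"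
    unfolding c_def lin nE by (simp add: algebra_simps)
  also have "\<dots> = transport4 N (\<lambda>x y z t u. f (g x y z) t u) x y z t u"
    unfolding transport4_def by (simp only: E_defs s_defs f_add ac_simps)
  finally show ?thesis unfolding b_def .
qed

context nijenhuis_operator
begin

lemma additive_N: "additive N"
  by unfold_locales (rule add)

lemma linear_br:
  "Vector_Spaces.linear scale scale (\<lambda>x. br x y z)"
  "Vector_Spaces.linear scale scale (\<lambda>y. br x y z)"
  "Vector_Spaces.linear scale scale (\<lambda>z. br x y z)"
  using trilinear_br unfolding trilinear_def by auto

lemma additive_br:
  "additive (\<lambda>x. br x y z)" "additive (\<lambda>y. br x y z)" "additive (\<lambda>z. br x y z)"
  using linear_br by (auto intro!: additive.intro simp: Vector_Spaces.linear_iff)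

text \<open>The Nijenhuis identity up to the order of summands; it is also the morphism
  property.\<close>

lemma N_nijenhuis_bracket: "N (nijenhuis_bracket br N x y z) = br (N x) (N y) (N z)"
  unfolding nijenhuis nijenhuis_bracket_def by (simp add: ac_simps)

lemma trilinear_nijenhuis_bracket: "trilinear scale (nijenhuis_bracket br N)"
proof -
  have br: "br (a + b) y z = br a y z + br b y z" "br x (a + b) z = br x a z + br x b z"
    "br x y (a + b) = br x y a + br x y b" "br (scale r a) y z = scale r (br a y z)"
    "br x (scale r a) z = scale r (br x a z)" "br x y (scale r a) = scale r (br x y a)"
    for a b x y z r
    using linear_br unfolding Vector_Spaces.linear_iff by blast+
  show ?thesis
    unfolding trilinear_def Vector_Spaces.linear_iff nijenhuis_bracket_def
    by (simp add: vector_space_axioms br add scale scale_right_distrib scale_right_diff_distrib)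
qed

text \<open>In each Leibniz term the arguments of the outer bracket are permuted so that the inner bracket
  comes first; neither the Nijenhuis identity nor \<open>nijenhuis_bracket\<close> depends on their order.\<close>

lemma nijenhuis_bracket_leibniz:
  defines "B \<equiv> nijenhuis_bracket br N"
  shows "B (B x y z) t u = B x y (B z t u) + B x (B y t u) z + B (B x t u) y z"
proof -
  note sym = nijenhuis_bracket_def ac_simps
  note nij = N_nijenhuis_bracket[symmetric]
  have B2: "B x b z = nijenhuis_bracket (\<lambda>b x z. br x b z) N b x z" for x b z
    unfolding B_def by (simp add: sym)
  have B3: "B x y b = nijenhuis_bracket (\<lambda>b x y. br x y b) N b x y" for x y b
    unfolding B_def by (simp add: sym)
  \<comment> \<open>General in its arguments because it also serves
    \<open>B (B x t u) y z\<close>.\<close>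
  have 1: "B (B x y z) t u = transport4 N (\<lambda>x y z t u. br (br x y z) t u) x y z t u" for x y z t u
    unfolding B_def by (intro nijenhuis_bracket_compose additive_N additive_br nij)
  have 2: "B x (B y t u) z = transport4 N (\<lambda>y t u x z. br x (br y t u) z) y t u x z"
    unfolding B2[of x] unfolding B_def
    by (intro nijenhuis_bracket_compose additive_N additive_br nij) (simp add: nij B2[unfolded B_def])
  have 3: "B x y (B z t u) = transport4 N (\<lambda>z t u x y. br x y (br z t u)) z t u x y"
    unfolding B3[of x] unfolding B_def
    by (intro nijenhuis_bracket_compose additive_N additive_br nij) (simp add: nij B3[unfolded B_def])
  have "(\<lambda>x y z t u. br (br x y z) t u) = (\<lambda>x y z t u.
      br x y (br z t u) + br x (br y t u) z + br (br x t u) y z)"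
    by (intro ext) (rule leibniz)
  then have "B (B x y z) t u = transport4 N (\<lambda>x y z t u.
      br x y (br z t u) + br x (br y t u) z + br (br x t u) y z) x y z t u"
    unfolding 1 by (rule arg_cong)
  also have "\<dots> = transport4 N (\<lambda>x y z t u. br x y (br z t u)) x y z t u
      + transport4 N (\<lambda>x y z t u. br x (br y t u) z) x y z t u
      + transport4 N (\<lambda>x y z t u. br (br x t u) y z) x y z t u"
    by (simp only: transport4_add[OF additive_N])
  \<comment> \<open>\<open>transport4\<close> is unchanged when the slots of \<open>F\<close> and
    the arguments are permuted alike, so each summand matches up to reordering of sums.\<close>
  also have "transport4 N (\<lambda>x y z t u. br x y (br z t u)) x y z t u = B x y (B z t u)"
    unfolding 3 transport4_def by (simp only: ac_simps)
  also have "transport4 N (\<lambda>x y z t u. br x (br y t u) z) x y z t u = B x (B y t u) z"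
    unfolding 2 transport4_def by (simp only: ac_simps)
  also have "transport4 N (\<lambda>x y z t u. br (br x t u) y z) x y z t u = B (B x t u) y z"
    unfolding 1 transport4_def by (simp only: ac_simps)
  finally show ?thesis .
qed

lemma ternary_leibniz_algebra_nijenhuis_bracket:
  "ternary_leibniz_algebra scale (nijenhuis_bracket br N)"
  by unfold_locales (rule trilinear_nijenhuis_bracket nijenhuis_bracket_leibniz)+

text \<open>\<open>N\<close> carries the deformed bracket to \<open>br\<close>, so applying it to
  the doubly deformed bracket replaces each inner bracket by \<open>br\<close> on
  \<open>N\<close>-images, which is the deformed bracket of \<open>N x\<close>, \<open>N y\<close>,
  \<open>N z\<close>.\<close>

lemma nijenhuis_nijenhuis_bracket:
  "nijenhuis_bracket br N (N x) (N y) (N z) =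
     N (nijenhuis_bracket (nijenhuis_bracket br N) N x y z)"
  unfolding nijenhuis_bracket_def[of "nijenhuis_bracket br N"] add diff N_nijenhuis_bracket
  unfolding nijenhuis_bracket_def by (simp add: add)

end

theorem theorem2p3:
  fixes scale :: "'k::field \<Rightarrow> 'v::ab_group_add \<Rightarrow> 'v"
    and br :: "'v \<Rightarrow> 'v \<Rightarrow> 'v \<Rightarrow> 'v"
    and N :: "'v \<Rightarrow> 'v"
  assumes "ternary_leibniz_algebra scale br"
    and "nijenhuis_operator scale br N"
  shows "ternary_leibniz_algebra scale (nijenhuis_bracket br N) \<and>
    ternary_leibniz_hom scale (nijenhuis_bracket br N) scale br N \<and>
    nijenhuis_operator scale (nijenhuis_bracket br N) N"
proof -
  interpret nijenhuis_operator scale br N by fact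
  interpret B: ternary_leibniz_algebra scale "nijenhuis_bracket br N"
    by (rule ternary_leibniz_algebra_nijenhuis_bracket)
  have "ternary_leibniz_hom scale (nijenhuis_bracket br N) scale br N"
    by unfold_locales (rule N_nijenhuis_bracket)
  moreover have "nijenhuis_operator scale (nijenhuis_bracket br N) N"
  proof unfold_locales
    fix x y z
    show "nijenhuis_bracket br N (N x) (N y) (N z) =
       N (nijenhuis_bracket br N (N x) (N y) z + nijenhuis_bracket br N (N x) y (N z)
          + nijenhuis_bracket br N x (N y) (N z)
          - N (nijenhuis_bracket br N (N x) y z + nijenhuis_bracket br N x (N y) z
            + nijenhuis_bracket br N x y (N z))
          + N (N (nijenhuis_bracket br N x y z)))"
      unfolding nijenhuis_nijenhuis_bracket
      unfolding nijenhuis_bracket_def[of "nijenhuis_bracket br N"] by (simp only: ac_simps)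
  qed
  ultimately show ?thesis using ternary_leibniz_algebra_nijenhuis_bracket by blast
qed

end
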